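(* Let $X$ be a locally compact Hausdorff space, $\theta:U\to V$ a partial automorphism on $X$, and $d\in\mathbb{N}$ with $d>1$. For every $\mu\in M^1_\theta(X,d)$ we have $\mu(D_{\mathrm{gl}})=\mu(D_+)=0$. If $X$ is compact and either $D_-$ or $D_{\mathrm{f}}$ is nonempty, then $M^1_\theta(X,d)$ is nonempty as well.
   Context: A partial automorphism on $X$ is a homeomorphism $\theta:U\to V$ between open subsets $U,V$ of $X$. For $n\in\mathbb{Z}$, $D_{-n}$ denotes the maximal domain of $\theta^n$ (so $D_0=X$, $D_{-1}=U$, $D_1=V$). Define $D_{\mathrm{gl}}=\bigcap_{n\in\mathbb{Z}}D_n$, $D_+=\left(\bigcap_{n>0}D_{-n}\right)\setminus D_{\mathrm{gl}}$, $D_-=\left(\bigcap_{n>0}D_n\right)\setminus D_{\mathrm{gl}}$, and $D_{\mathrm{f}}=\left(\bigcup_{n\geq0}D_n\setminus D_{n+1}\right)\cap\left(\bigcup_{n\geq0}D_{-n}\setminus D_{-n-1}\right)$. $M^1_\theta(X,d)$ is the set of regular Borel probability measures $\mu$ on $X$ that are $d$-conformal with respect to $\theta$, i.e. $\mu(\theta(Y))=d\,\mu(Y)$ for all measurable $Y\subset U$. *)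

theory Defs
  imports "HOL-Probability.Probability"
begin

text \<open>
  The underlying space is the whole type. A partial automorphism is given by a total function
  together with its domain \<open>U\<close>; values outside \<open>U\<close> are never used.
\<close>

definition partial_automorphism ::
    "'a::topological_space set \<Rightarrow> 'a set \<Rightarrow> ('a \<Rightarrow> 'a) \<Rightarrow> bool" where
  "partial_automorphism U V \<theta> \<longleftrightarrow>
     open U \<and> open V \<and> (\<exists>\<theta>'. homeomorphism U V \<theta> \<theta>')"

definition partial_map :: "'a set \<Rightarrow> ('a \<Rightarrow> 'a) \<Rightarrow> ('a \<rightharpoonup> 'a)" where
  "partial_map U \<theta> = (\<lambda>x. if x \<in> U then Some (\<theta> x) else None)"

definition partial_inverse :: "'a set \<Rightarrow> ('a \<Rightarrow> 'a) \<Rightarrow> ('a \<rightharpoonup> 'a)" where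
  "partial_inverse U \<theta> = partial_map (\<theta> ` U) (inv_into U \<theta>)"

text \<open>
  Map composition is defined wherever it makes sense, so the domain of a power taken in this
  way is its maximal domain.
\<close>

primrec partial_pow :: "('a \<rightharpoonup> 'a) \<Rightarrow> nat \<Rightarrow> ('a \<rightharpoonup> 'a)" where
  "partial_pow f 0 = Some"
| "partial_pow f (Suc n) = f \<circ>\<^sub>m partial_pow f n"

definition partial_powi :: "'a set \<Rightarrow> ('a \<Rightarrow> 'a) \<Rightarrow> int \<Rightarrow> ('a \<rightharpoonup> 'a)" where
  "partial_powi U \<theta> n =
     (if n \<ge> 0 then partial_pow (partial_map U \<theta>) (nat n)
      else partial_pow (partial_inverse U \<theta>) (nat (- n)))"

text \<open>Note the sign: \<open>D U \<theta> (- n)\<close> is the domain of the \<open>n\<close>-th power.\<close>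

definition D :: "'a set \<Rightarrow> ('a \<Rightarrow> 'a) \<Rightarrow> int \<Rightarrow> 'a set" where
  "D U \<theta> n = dom (partial_powi U \<theta> (- n))"

lemma D_0: "D U \<theta> 0 = UNIV"
  by (auto simp: D_def partial_powi_def)

lemma D_minus_1: "D U \<theta> (- 1) = U"
  by (auto simp: D_def partial_powi_def partial_map_def map_comp_def split: if_splits)

lemma D_1: "D U \<theta> 1 = \<theta> ` U"
  by (auto simp: D_def partial_powi_def partial_inverse_def partial_map_def map_comp_def
           split: if_splits)

definition D_gl :: "'a set \<Rightarrow> ('a \<Rightarrow> 'a) \<Rightarrow> 'a set" where
  "D_gl U \<theta> = (\<Inter>n::int. D U \<theta> n)"

definition D_plus :: "'a set \<Rightarrow> ('a \<Rightarrow> 'a) \<Rightarrow> 'a set" where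
  "D_plus U \<theta> = (\<Inter>n\<in>{0::int<..}. D U \<theta> (- n)) - D_gl U \<theta>"

definition D_minus :: "'a set \<Rightarrow> ('a \<Rightarrow> 'a) \<Rightarrow> 'a set" where
  "D_minus U \<theta> = (\<Inter>n\<in>{0::int<..}. D U \<theta> n) - D_gl U \<theta>"

definition D_f :: "'a set \<Rightarrow> ('a \<Rightarrow> 'a) \<Rightarrow> 'a set" where
  "D_f U \<theta> =
     (\<Union>n\<in>{0::int..}. D U \<theta> n - D U \<theta> (n + 1)) \<inter>
     (\<Union>n\<in>{0::int..}. D U \<theta> (- n) - D U \<theta> (- n - 1))"

text \<open>
  For finite measures, inner regularity on all Borel sets (rather than on open sets only) is no
  extra restriction.
\<close>

definition regular_borel_measure :: "'a::topological_space measure \<Rightarrow> bool" where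
  "regular_borel_measure \<mu> \<longleftrightarrow>
     sets \<mu> = sets borel \<and>
     (\<forall>A\<in>sets borel.
        emeasure \<mu> A = (SUP K\<in>{K. compact K \<and> K \<subseteq> A}. emeasure \<mu> K) \<and>
        emeasure \<mu> A = (INF W\<in>{W. open W \<and> A \<subseteq> W}. emeasure \<mu> W))"

definition conformal ::
    "'a::topological_space set \<Rightarrow> ('a \<Rightarrow> 'a) \<Rightarrow> nat \<Rightarrow> 'a measure \<Rightarrow> bool" where
  "conformal U \<theta> d \<mu> \<longleftrightarrow>
     (\<forall>Y\<in>sets borel. Y \<subseteq> U \<longrightarrow> emeasure \<mu> (\<theta> ` Y) = of_nat d * emeasure \<mu> Y)"

definition conformal_measures ::
    "'a::topological_space set \<Rightarrow> ('a \<Rightarrow> 'a) \<Rightarrow> nat \<Rightarrow> 'a measure set" where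
  "conformal_measures U \<theta> d =
     {\<mu>. prob_space \<mu> \<and> regular_borel_measure \<mu> \<and> conformal U \<theta> d \<mu>}"

end

theory Submission
  imports Defs
begin

text \<open>
  Write \<open>A\<close> for the set of points whose forward orbit never leaves \<open>U\<close>. It is a Borel set with
  \<open>\<theta> ` A \<subseteq> A\<close>, so a conformal probability measure \<open>\<mu>\<close> satisfies \<open>d * \<mu> A = \<mu> (\<theta> ` A) \<le> \<mu> A\<close>.
  As \<open>d > 1\<close> and \<open>\<mu> A\<close> is finite, \<open>\<mu> A = 0\<close>; both \<open>D_gl\<close> and \<open>D_plus\<close> are Borel subsets of \<open>A\<close>
  (lemma \<open>conformal_null_forward_set\<close>).

  For existence, the forward orbit of a point of \<open>D_minus\<close> or \<open>D_f\<close> ends at a point outside \<open>U\<close>,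
  so \<open>U \<noteq> UNIV\<close>. Conversely a point \<open>z \<notin> U\<close> is enough to build a conformal measure: follow the
  backward orbit \<open>z, \<theta>\<inverse> z, \<theta>\<inverse>\<^sup>2 z, \<dots>\<close> for as long as it is defined and put mass proportional to
  \<open>(1 / d) ^ k\<close> on its \<open>k\<close>-th point. Applying \<open>\<theta>\<close> moves each atom one step towards \<open>z\<close>, where the
  weight is \<open>d\<close> times larger. Neither end of the orbit spoils this: \<open>z\<close> does not lie in \<open>U\<close>, and
  a last point of the backward orbit does not lie in \<open>V\<close>. Atomic measures on a Hausdorff space
  are regular because finite sets are compact (lemmas \<open>ex_conformal_measure\<close> and
  \<open>regular_borel_measure_distr_pmf\<close>).
\<close>

section \<open>Domains of the iterates\<close>

text \<open>
  The recursion for powers peels off the last application of the map. Peeling off the first one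
  instead presents the domain of the next power as a preimage under \<open>\<theta>\<close>, which gives openness and
  forward invariance of these domains.
\<close>

lemma partial_pow_Suc_right: "partial_pow f (Suc n) = partial_pow f n \<circ>\<^sub>m f"
proof (induction n)
  case 0
  show ?case by (auto simp: map_comp_def fun_eq_iff split: option.split)
next
  case (Suc n)
  have "partial_pow f (Suc (Suc n)) = f \<circ>\<^sub>m (partial_pow f n \<circ>\<^sub>m f)"
    using Suc.IH by simp
  then show ?case by (auto simp: map_comp_def fun_eq_iff split: option.split)
qed

lemma dom_partial_pow_Suc:
  "dom (partial_pow (partial_map U \<theta>) (Suc n)) = U \<inter> \<theta> -` dom (partial_pow (partial_map U \<theta>) n)"
  unfolding partial_pow_Suc_right
  by (auto simp: map_comp_def partial_map_def split: if_splits)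

lemma open_dom_partial_pow:
  assumes "open U" "continuous_on U \<theta>"
  shows "open (dom (partial_pow (partial_map U \<theta>) n))"
proof (induction n)
  case (Suc n)
  then show ?case
    unfolding dom_partial_pow_Suc by (rule continuous_open_preimage[OF assms(2,1)])
qed auto

lemma D_uminus_of_nat: "D U \<theta> (- int n) = dom (partial_pow (partial_map U \<theta>) n)"
  by (simp add: D_def partial_powi_def)

lemma D_of_nat:
  "D U \<theta> (int n) = dom (partial_pow (partial_map (\<theta> ` U) (inv_into U \<theta>)) n)"
  by (cases n) (simp_all add: D_def partial_powi_def partial_inverse_def nat_add_distrib)

lemma D_UNIV: "D UNIV \<theta> (- int n) = UNIV"
  unfolding D_uminus_of_nat
  by (induction n) (auto simp: dom_partial_pow_Suc simp del: partial_pow.simps(2))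

lemma homeomorphism_inv_into:
  assumes "homeomorphism U V \<theta> \<theta>'" "y \<in> V"
  shows "inv_into U \<theta> y = \<theta>' y"
  using assms by (auto simp: homeomorphism_def intro!: inv_into_f_eq inj_on_inverseI[of U \<theta>' \<theta>])

lemma open_D:
  assumes "partial_automorphism U V \<theta>"
  shows "open (D U \<theta> n)"
proof -
  obtain \<theta>' where UV: "open U" "open V" and h: "homeomorphism U V \<theta> \<theta>'"
    using assms by (auto simp: partial_automorphism_def)
  have V: "\<theta> ` U = V" and cont: "continuous_on U \<theta>" "continuous_on V \<theta>'"
    using h by (auto simp: homeomorphism_def)
  have "continuous_on V (inv_into U \<theta>)"
    using cont(2) homeomorphism_inv_into[OF h] by (simp cong: continuous_on_cong)
  then show ?thesis
    using open_dom_partial_pow[OF UV(1) cont(1)] open_dom_partial_pow[OF UV(2)]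
    by (cases n rule: int_cases2) (auto simp: D_uminus_of_nat D_of_nat V)
qed

lemma borel_image_partial_automorphism:
  assumes "partial_automorphism U V \<theta>" "Y \<in> sets borel" "Y \<subseteq> U"
  shows "\<theta> ` Y \<in> sets borel"
proof -
  obtain \<theta>' where V: "open V" and h: "homeomorphism U V \<theta> \<theta>'"
    using assms(1) by (auto simp: partial_automorphism_def)
  have "\<theta>' \<in> borel_measurable (restrict_space borel V)"
    using h by (intro borel_measurable_continuous_on_restrict) (auto simp: homeomorphism_def)
  then have "\<theta>' -` Y \<inter> V \<in> sets (restrict_space borel V)"
    using assms(2) by (auto dest: measurable_sets simp: space_restrict_space)
  then have "\<theta>' -` Y \<inter> V \<in> sets borel"
    using V by (auto simp: sets_restrict_space)
  moreover have "\<theta>' -` Y \<inter> V = \<theta> ` Y"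
    using h assms(3) by (force simp: homeomorphism_def)
  ultimately show ?thesis by simp
qed

section \<open>Conformal measures do not see infinite forward orbits\<close>

text \<open>
  The set below is mapped into itself, while \<open>\<theta>\<close> multiplies measures by \<open>d > 1\<close>: a finite mass
  that does not grow under this must be zero.
\<close>

lemma conformal_null_forward_set:
  assumes \<theta>: "partial_automorphism U V \<theta>" and d: "d > 1" and \<mu>: "\<mu> \<in> conformal_measures U \<theta> d"
  shows "(\<Inter>n\<in>{0::int<..}. D U \<theta> (- n)) \<in> null_sets \<mu>" (is "?A \<in> _")
proof -
  interpret prob_space \<mu>
    using \<mu> by (simp add: conformal_measures_def)
  have sets: "sets \<mu> = sets borel" and conf: "conformal U \<theta> d \<mu>"
    using \<mu> by (auto simp: conformal_measures_def regular_borel_measure_def)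
  have A_eq: "?A = (\<Inter>n. D U \<theta> (- int (Suc n)))"
  proof (rule INF_eq)
    show "\<exists>k\<in>UNIV. D U \<theta> (- int (Suc k)) \<le> D U \<theta> (- n)" if "n \<in> {0<..}" for n :: int
      using that by (intro bexI[of _ "nat n - 1"]) (auto simp: of_nat_diff)
    show "\<exists>n\<in>{0<..}. D U \<theta> (- n) \<le> D U \<theta> (- int (Suc k))" for k
      by (intro bexI[of _ "int (Suc k)"]) auto
  qed
  have A: "?A \<in> sets borel"
    unfolding A_eq by (rule sets.countable_INT'') (simp_all add: open_D[OF \<theta>])
  have "?A \<subseteq> U"
    using INF_lower[of 1 "{0<..}" "\<lambda>n. D U \<theta> (- n)"] by (simp add: D_minus_1)
  then have "emeasure \<mu> (\<theta> ` ?A) = of_nat d * emeasure \<mu> ?A"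
    using conf A unfolding conformal_def by blast
  moreover have "\<theta> ` ?A \<subseteq> ?A"
    unfolding A_eq D_uminus_of_nat using dom_partial_pow_Suc[of U \<theta> "Suc _"] by blast
  then have "emeasure \<mu> (\<theta> ` ?A) \<le> emeasure \<mu> ?A"
    using A sets by (intro emeasure_mono) simp_all
  ultimately have "of_nat d * emeasure \<mu> ?A \<le> emeasure \<mu> ?A" by simp
  then have "real d * prob ?A \<le> prob ?A"
    by (simp add: emeasure_eq_measure ennreal_of_nat_eq_real_of_nat flip: ennreal_mult)
  then have "prob ?A = 0"
    using d measure_nonneg[of \<mu> ?A] by (simp only: mult_le_cancel_right2) linarith
  then have "emeasure \<mu> ?A = 0"
    by (simp add: emeasure_eq_measure)
  then show ?thesis using A sets by auto
qed

section \<open>Conformal measures from a backward orbit\<close>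

text \<open>
  Passing to complements exchanges compact subsets of \<open>- A\<close> with certain open supersets of \<open>A\<close>,
  so for a probability measure on a Hausdorff space it suffices to verify inner regularity.
\<close>

lemma regular_borel_measureI:
  fixes \<mu> :: "'a::t2_space measure"
  assumes "prob_space \<mu>" and sets: "sets \<mu> = sets borel"
    and inner: "\<And>A. A \<in> sets borel \<Longrightarrow>
      emeasure \<mu> A \<le> (SUP K\<in>{K. compact K \<and> K \<subseteq> A}. emeasure \<mu> K)"
  shows "regular_borel_measure \<mu>"
proof -
  interpret prob_space \<mu> by fact
  have space: "space \<mu> = UNIV"
    using sets_eq_imp_space_eq[OF sets] by simp
  have inner_eq: "emeasure \<mu> A = (SUP K\<in>{K. compact K \<and> K \<subseteq> A}. emeasure \<mu> K)"
    if "A \<in> sets borel" for A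
    using inner[OF that] that by (intro antisym SUP_least) (auto intro: emeasure_mono simp: sets)
  have compl: "emeasure \<mu> (- B) = 1 - emeasure \<mu> B" if "B \<in> sets borel" for B
    using emeasure_compl[of B \<mu>] that
    by (simp add: sets space emeasure_space_1[unfolded space] Compl_eq_Diff_UNIV)
  have outer: "emeasure \<mu> A = (INF W\<in>{W. open W \<and> A \<subseteq> W}. emeasure \<mu> W)"
    if A: "A \<in> sets borel" for A
  proof (rule antisym)
    show "emeasure \<mu> A \<le> (INF W\<in>{W. open W \<and> A \<subseteq> W}. emeasure \<mu> W)"
      by (intro INF_greatest) (auto intro: emeasure_mono simp: sets)
    have "(INF W\<in>{W. open W \<and> A \<subseteq> W}. emeasure \<mu> W)
        \<le> (INF K\<in>{K. compact K \<and> K \<subseteq> - A}. 1 - emeasure \<mu> K)"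
    proof (rule INF_mono)
      fix K assume "K \<in> {K. compact K \<and> K \<subseteq> - A}"
      then show "\<exists>W\<in>{W. open W \<and> A \<subseteq> W}. emeasure \<mu> W \<le> 1 - emeasure \<mu> K"
        using compl[of K] by (intro bexI[of _ "- K"]) (auto dest: compact_imp_closed)
    qed
    also have "\<dots> = 1 - emeasure \<mu> (- A)"
      using A inner_eq[of "- A"] by (subst ennreal_SUP_const_minus) auto
    also have "\<dots> = emeasure \<mu> A"
      using compl[of "- A"] A by simp
    finally show "(INF W\<in>{W. open W \<and> A \<subseteq> W}. emeasure \<mu> W) \<le> emeasure \<mu> A" .
  qed
  show ?thesis
    unfolding regular_borel_measure_def using sets inner_eq outer by blast
qed

lemma regular_borel_measure_distr_pmf:
  fixes x :: "nat \<Rightarrow> 'a::t2_space"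
  shows "regular_borel_measure (distr (measure_pmf p) borel x)" (is "regular_borel_measure ?\<mu>")
proof (rule regular_borel_measureI)
  show "prob_space ?\<mu>"
    by (intro measure_pmf.prob_space_distr) simp
  fix A :: "'a set" assume A: "A \<in> sets borel"
  have "emeasure ?\<mu> A = emeasure p (\<Union>n. x -` A \<inter> {..n})"
    using A by (auto simp: emeasure_distr intro!: arg_cong[where f = "emeasure p"])
  also have "\<dots> = (SUP n. emeasure p (x -` A \<inter> {..n}))"
    by (intro SUP_emeasure_incseq[symmetric]) (auto simp: incseq_def)
  also have "\<dots> \<le> (SUP K\<in>{K. compact K \<and> K \<subseteq> A}. emeasure ?\<mu> K)"
  proof (rule SUP_mono)
    fix n
    let ?K = "x ` (x -` A \<inter> {..n})"
    have "compact ?K"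
      by (intro finite_imp_compact) auto
    moreover have "emeasure p (x -` A \<inter> {..n}) \<le> emeasure ?\<mu> ?K"
      using compact_imp_closed[OF \<open>compact ?K\<close>]
      by (auto simp: emeasure_distr intro!: emeasure_mono)
    ultimately show "\<exists>K\<in>{K. compact K \<and> K \<subseteq> A}. emeasure p (x -` A \<inter> {..n}) \<le> emeasure ?\<mu> K"
      by blast
  qed
  finally show "emeasure ?\<mu> A \<le> (SUP K\<in>{K. compact K \<and> K \<subseteq> A}. emeasure ?\<mu> K)" .
qed simp

text \<open>
  Weights proportional to \<open>(1 / d) ^ k\<close> on an index set \<open>I\<close> are the geometric distribution with
  parameter \<open>1 - 1 / d\<close> conditioned on \<open>I\<close>. Conditioning
  rescales all weights on \<open>I\<close> alike, so neighbouring ones keep the ratio \<open>d\<close>.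
\<close>

lemma emeasure_cond_geometric_Suc:
  fixes d :: nat
  assumes d: "d > 1" and I: "0 \<in> I" "B \<subseteq> I" "Suc ` B \<subseteq> I"
  defines "p \<equiv> cond_pmf (geometric_pmf (1 - 1 / real d)) I"
  shows "emeasure p B = of_nat d * emeasure p (Suc ` B)"
proof -
  let ?g = "geometric_pmf (1 - 1 / real d)"
  have q: "0 < 1 - 1 / real d" "1 - 1 / real d \<le> 1"
    using d by auto
  have ne: "set_pmf ?g \<inter> I \<noteq> {}"
    using d I(1) q by (auto simp: set_pmf_iff)
  have ratio: "pmf p k = real d * pmf p (Suc k)" if "k \<in> B" for k
    using that I d q by (auto simp: p_def pmf_cond[OF ne])
  have "emeasure p B = (\<integral>\<^sup>+ k. pmf p k \<partial>count_space B)"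
    by (simp add: nn_integral_pmf)
  also have "\<dots> = (\<integral>\<^sup>+ k. of_nat d * ennreal (pmf p (Suc k)) \<partial>count_space B)"
    by (intro nn_integral_cong)
      (simp add: ratio ennreal_of_nat_eq_real_of_nat ennreal_mult)
  also have "\<dots> = of_nat d * (\<integral>\<^sup>+ k. pmf p (Suc k) \<partial>count_space B)"
    by (intro nn_integral_cmult) simp
  also have "(\<integral>\<^sup>+ k. pmf p (Suc k) \<partial>count_space B) = emeasure p (Suc ` B)"
    by (rule nn_integral_pmf') simp
  finally show ?thesis .
qed

text \<open>
  The backward orbit of \<open>z\<close> is handled through its time set: the measure is the image of a weight
  on times, and \<open>Suc\<close> maps the times at which the orbit visits \<open>\<theta> ` Y\<close> onto those at which it
  visits \<open>Y\<close>. Surjectivity is where \<open>z \<notin> U\<close> enters: time \<open>0\<close> is never a visit to \<open>Y \<subseteq> U\<close>.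
\<close>

lemma ex_conformal_measure:
  fixes U V :: "'a::t2_space set" and d :: nat
  assumes \<theta>: "partial_automorphism U V \<theta>" and d: "d > 1" and z: "z \<notin> U"
  shows "conformal_measures U \<theta> d \<noteq> {}"
proof -
  obtain \<theta>' where h: "homeomorphism U V \<theta> \<theta>'"
    using \<theta> by (auto simp: partial_automorphism_def)
  define x where "x k = (\<theta>' ^^ k) z" for k
  (* the backward orbit of z is defined up to time k iff its earlier points all lie in V *)
  define I where "I = {k. \<forall>j<k. x j \<in> V}"
  define p where "p = cond_pmf (geometric_pmf (1 - 1 / real d)) I"
  define \<mu> where "\<mu> = distr (measure_pmf p) borel x"
  have "0 \<in> I" by (simp add: I_def)
  have set_p: "set_pmf p \<subseteq> I"
  proof -
    have "set_pmf (geometric_pmf (1 - 1 / real d)) \<inter> I \<noteq> {}"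
      using d \<open>0 \<in> I\<close> by (auto simp: set_pmf_iff)
    then show ?thesis by (simp add: p_def set_cond_pmf)
  qed
  have \<mu>_eq: "emeasure \<mu> A = emeasure p {k \<in> I. x k \<in> A}" if "A \<in> sets borel" for A
  proof -
    have "emeasure \<mu> A = emeasure p (x -` A)"
      using that by (simp add: \<mu>_def emeasure_distr)
    also have "\<dots> = emeasure p {k \<in> I. x k \<in> A}"
      using set_p by (intro emeasure_eq_AE) (auto simp: AE_measure_pmf_iff)
    finally show ?thesis .
  qed
  have "conformal U \<theta> d \<mu>"
    unfolding conformal_def
  proof (intro ballI impI)
    fix Y assume Y: "Y \<in> sets borel" "Y \<subseteq> U"
    let ?B = "{k. Suc k \<in> I \<and> x (Suc k) \<in> Y}"
    have step: "k \<in> I \<and> x k \<in> \<theta> ` Y \<longleftrightarrow> Suc k \<in> I \<and> x (Suc k) \<in> Y" for k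
    proof -
      have "x k \<in> \<theta> ` Y \<longleftrightarrow> x k \<in> V \<and> x (Suc k) \<in> Y"
        using h Y(2) by (force simp: homeomorphism_def x_def)
      then show ?thesis by (auto simp: I_def less_Suc_eq)
    qed
    have "{k \<in> I. x k \<in> Y} = Suc ` ?B"
    proof -
      have "x 0 \<notin> Y" using z Y(2) by (auto simp: x_def)
      then show ?thesis by (auto simp: image_iff) (metis not0_implies_Suc)
    qed
    moreover have "emeasure p ?B = of_nat d * emeasure p (Suc ` ?B)"
      unfolding p_def using \<open>0 \<in> I\<close>
      by (intro emeasure_cond_geometric_Suc[OF d]) (auto simp: I_def)
    ultimately show "emeasure \<mu> (\<theta> ` Y) = of_nat d * emeasure \<mu> Y"
      using borel_image_partial_automorphism[OF \<theta> Y] Y(1) by (simp add: \<mu>_eq step)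
  qed
  moreover have "prob_space \<mu>"
    unfolding \<mu>_def by (intro measure_pmf.prob_space_distr) simp
  moreover have "regular_borel_measure \<mu>"
    unfolding \<mu>_def by (rule regular_borel_measure_distr_pmf)
  ultimately show ?thesis by (auto simp: conformal_measures_def)
qed

theorem proposition3p7:
  fixes U V :: "'a::t2_space set" and \<theta> :: "'a \<Rightarrow> 'a" and d :: nat
  assumes "locally_compact_space (euclidean :: 'a topology)"
    and "partial_automorphism U V \<theta>"
    and "d > 1"
  shows "(\<forall>\<mu>\<in>conformal_measures U \<theta> d. D_gl U \<theta> \<in> null_sets \<mu> \<and> D_plus U \<theta> \<in> null_sets \<mu>) \<and>
         (compact (UNIV :: 'a set) \<and> (D_minus U \<theta> \<noteq> {} \<or> D_f U \<theta> \<noteq> {}) \<longrightarrow>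
            conformal_measures U \<theta> d \<noteq> {})"
proof (intro conjI ballI impI)
  fix \<mu> assume \<mu>: "\<mu> \<in> conformal_measures U \<theta> d"
  note null = conformal_null_forward_set[OF assms(2,3) \<mu>]
  have "D_gl U \<theta> \<in> sets borel"
    unfolding D_gl_def by (rule sets.countable_INT'') (simp_all add: open_D[OF assms(2)])
  then have gl: "D_gl U \<theta> \<in> sets \<mu>"
    using \<mu> by (simp add: conformal_measures_def regular_borel_measure_def)
  show "D_gl U \<theta> \<in> null_sets \<mu>"
    by (rule null_sets_subset[OF null gl]) (auto simp: D_gl_def)
  show "D_plus U \<theta> \<in> null_sets \<mu>"
    unfolding D_plus_def using null gl
    by (intro null_sets_subset[OF null]) auto
next
  assume ne: "compact (UNIV :: 'a set) \<and> (D_minus U \<theta> \<noteq> {} \<or> D_f U \<theta> \<noteq> {})"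
  (* if U were everything, all forward orbits would be infinite *)
  have D_minus: "D_minus UNIV \<theta> = {}"
  proof -
    have "(\<Inter>n\<in>{0::int<..}. D UNIV \<theta> n) \<subseteq> D UNIV \<theta> m" for m
    proof (cases "m > 0")
      case False
      then show ?thesis using D_UNIV[of \<theta> "nat (- m)"] by simp
    qed auto
    then show ?thesis by (auto simp: D_minus_def D_gl_def)
  qed
  have D_f: "D_f UNIV \<theta> = {}"
  proof -
    have "D UNIV \<theta> (- n - 1) = UNIV" if "n \<ge> 0" for n
      using D_UNIV[of \<theta> "nat (n + 1)"] that by simp
    then show ?thesis by (auto simp: D_f_def)
  qed
  have "U \<noteq> UNIV"
    using ne D_minus D_f by metis
  then obtain z where "z \<notin> U" by auto
  then show "conformal_measures U \<theta> d \<noteq> {}"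
    by (rule ex_conformal_measure[OF assms(2,3)])
qed

end
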